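(* Let $n,k$ be positive integers with $4\le 2k\le n$. (1) If $\mathcal{G}\subseteq\mathcal{G}_k(\overline{1})$ is a principal generating set (PGS), then the family $\mathcal{F}(\mathcal{G})\cup\mathcal{F}(\mathcal{H}(\mathcal{G}))\subseteq\binom{[n]}{k}$ is a maximal left-compressed intersecting family (MLCIF). (2) Conversely, for every MLCIF $\mathcal{A}\subseteq\binom{[n]}{k}$ there exists a PGS $\mathcal{G}$ such that $\mathcal{A}=\mathcal{F}(\mathcal{G})\cup\mathcal{F}(\mathcal{H}(\mathcal{G}))$.
   Context: Notation: $[n]=\{1,\dots,n\}$, $[m,n]=\{m,m+1,\dots,n\}$; $\binom{[n]}{k}$ is the set of all $k$-element subsets of $[n]$, and $\binom{[n]}{\le k}$ the set of all subsets of size at most $k$. Sets are always listed in increasing order. Orders: for two sets of the same size, $A=\{a_1<\dots<a_r\}$ and $B=\{b_1<\dots<b_r\}$, write $A\le B$ if $a_i\le b_i$ for all $i$. For $A=\{a_1<\dots<a_r\}$, $B=\{b_1<\dots<b_s\}$ write $A\preceq B$ if $r\ge s$ and $a_i\le b_i$ for all $1\le i\le s$. Families: $\mathcal{A}\subseteq\binom{[n]}{k}$ is intersecting if $S\cap T\ne\emptyset$ for all $S,T\in\mathcal{A}$; left-compressed if $A\in\mathcal{A}$, $B\in\binom{[n]}{k}$, $B\le A$ imply $B\in\mathcal{A}$. An intersecting family $\mathcal{A}\subseteq\binom{[n]}{k}$ is maximal if no other $k$-subset of $[n]$ can be added to it while preserving the intersecting property. An MLCIF is a maximal left-compressed intersecting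 family $\mathcal{A}\subseteq\binom{[n]}{k}$. Strong intersection: subsets $A,B$ of $[n]$ (possibly equal) are strongly intersecting if $A'\cap B'\ne\emptyset$ for all $A',B'\subseteq[n]$ with $A'\le A$, $B'\le B$. A family is strongly intersecting if every pair of its members (including a member paired with itself) is strongly intersecting. Generated families: for a collection $\mathcal{G}$ of subsets of $[n]$ of size at most $k$, $\mathcal{F}(\mathcal{G})=\{S\in\binom{[n]}{k}: S\preceq G\text{ for some }G\in\mathcal{G}\}$. PGS: $\mathcal{G}_k=\{G\in\binom{[2k-1]}{\le k}: |G\cap[k+|G|-1]|=|G|\}$ (i.e. the largest element of $G$ is at most $k+|G|-1$), and $\mathcal{G}_k(\overline{1})=\{G\in\mathcal{G}_k: 1\notin G\}$. A subfamily $\mathcal{G}\subseteq\mathcal{G}_k(\overline{1})$ is a principal generating set (PGS) if it is strongly intersecting. Meet: for sets $A^1,\dots,A^m$ with $A^j=\{a^j_1<\dots<a^j_{r_j}\}$ and $d=\max_j r_j$, define $A^1\wedge\dots\wedge A^m=\{a_1,\dots,a_d\}$ with $a_i=\min\{a^j_i:1\le j\le m\}$, where $a^j_i=+\infty$ if $i>r_j$. The family $\mathcal{H}(\mathcal{G})$: let $\mathcal{G}=\{G^1,\dots,G^m\}$ be a PGS with $G^j=\{g^j_1<\dots<g^j_{r_j}\}$. For $i_j\in[r_j]$ put $G^j_{i_j}=\{1\}\cup[i_j+1,g^j_{i_j}]$. Then $$\mathcal{H}(\mathcal{G})=\{H\subseteq[n]: H\le G^1_{i_1}\wedge\dots\wedge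 G^m_{i_m}\text{ for some }(i_1,\dots,i_m)\in[r_1]\times\dots\times[r_m]\}.$$ The empty family is a PGS, with the convention that the empty meet is $\{1\}$, so $\mathcal{H}(\emptyset)=\{\{1\}\}$. *)

theory Defs
  imports "HOL-Library.Ramsey" "HOL-Library.FuncSet"
begin

text \<open>
  The ground set \<open>[n]\<close> is \<open>{1..n}\<close>, and \<open>nsets {1..n} k\<close> is the collection of its \<open>k\<close>-element
  subsets. The notions below are meant for finite sets of positive integers; a family is a set of
  such sets.
\<close>

text \<open>Elements are numbered from 1: \<open>elt A i\<close> is \<open>a\<^sub>i\<close> in \<open>A = {a\<^sub>1 < \<dots> < a\<^sub>r}\<close>, for \<open>1 \<le> i \<le> r\<close>.\<close>

definition elt :: "nat set \<Rightarrow> nat \<Rightarrow> nat" where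
  "elt A i = sorted_list_of_set A ! (i - 1)"

definition set_le :: "nat set \<Rightarrow> nat set \<Rightarrow> bool" where
  "set_le A B \<longleftrightarrow> card A = card B \<and> (\<forall>i\<in>{1..card A}. elt A i \<le> elt B i)"

definition set_preceq :: "nat set \<Rightarrow> nat set \<Rightarrow> bool" where
  "set_preceq A B \<longleftrightarrow> card A \<ge> card B \<and> (\<forall>i\<in>{1..card B}. elt A i \<le> elt B i)"

definition intersecting :: "nat set set \<Rightarrow> bool" where
  "intersecting \<A> \<longleftrightarrow> (\<forall>S\<in>\<A>. \<forall>T\<in>\<A>. S \<inter> T \<noteq> {})"

definition left_compressed :: "nat \<Rightarrow> nat \<Rightarrow> nat set set \<Rightarrow> bool" where
  "left_compressed n k \<A> \<longleftrightarrow> (\<forall>A\<in>\<A>. \<forall>B\<in>nsets {1..n} k. set_le B A \<longrightarrow> B \<in> \<A>)"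

definition maximal_intersecting :: "nat \<Rightarrow> nat \<Rightarrow> nat set set \<Rightarrow> bool" where
  "maximal_intersecting n k \<A> \<longleftrightarrow>
     intersecting \<A> \<and> (\<forall>S\<in>nsets {1..n} k - \<A>. \<not> intersecting (insert S \<A>))"

text \<open>Maximality is among all intersecting families of \<open>k\<close>-subsets, not only the left-compressed ones.\<close>

definition MLCIF :: "nat \<Rightarrow> nat \<Rightarrow> nat set set \<Rightarrow> bool" where
  "MLCIF n k \<A> \<longleftrightarrow>
     \<A> \<subseteq> nsets {1..n} k \<and> left_compressed n k \<A> \<and> maximal_intersecting n k \<A>"

definition strongly_intersecting_sets :: "nat \<Rightarrow> nat set \<Rightarrow> nat set \<Rightarrow> bool" where
  "strongly_intersecting_sets n A B \<longleftrightarrow>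
     (\<forall>A' B'. A' \<subseteq> {1..n} \<longrightarrow> B' \<subseteq> {1..n} \<longrightarrow> set_le A' A \<longrightarrow> set_le B' B \<longrightarrow> A' \<inter> B' \<noteq> {})"

definition strongly_intersecting :: "nat \<Rightarrow> nat set set \<Rightarrow> bool" where
  "strongly_intersecting n \<A> \<longleftrightarrow> (\<forall>A\<in>\<A>. \<forall>B\<in>\<A>. strongly_intersecting_sets n A B)"

definition gen_family :: "nat \<Rightarrow> nat \<Rightarrow> nat set set \<Rightarrow> nat set set" where
  "gen_family n k \<G> = {S \<in> nsets {1..n} k. \<exists>G\<in>\<G>. set_preceq S G}"

definition generators :: "nat \<Rightarrow> nat set set" where
  "generators k =
     {G. G \<subseteq> {1..2 * k - 1} \<and> card G \<le> k \<and> card (G \<inter> {1..k + card G - 1}) = card G}"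

definition generators_avoiding_1 :: "nat \<Rightarrow> nat set set" where
  "generators_avoiding_1 k = {G \<in> generators k. 1 \<notin> G}"

definition PGS :: "nat \<Rightarrow> nat \<Rightarrow> nat set set \<Rightarrow> bool" where
  "PGS n k \<G> \<longleftrightarrow> \<G> \<subseteq> generators_avoiding_1 k \<and> strongly_intersecting n \<G>"

text \<open>
  The meet of a finite collection of sets. A set with fewer than \<open>i\<close> elements has \<open>\<infinity>\<close> as its
  \<open>i\<close>-th element, so it is left out of the \<open>i\<close>-th minimum; for \<open>i\<close> at most the largest
  cardinality, some set remains. The empty meet is \<open>{1}\<close> by convention.
\<close>

definition meet :: "nat set set \<Rightarrow> nat set" where
  "meet \<S> = (if \<S> = {} then {1}
     else (\<lambda>i. Min {elt A i | A. A \<in> \<S> \<and> i \<le> card A}) ` {1..Max (card ` \<S>)})"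

definition block :: "nat set \<Rightarrow> nat \<Rightarrow> nat set" where
  "block G i = {1} \<union> {i + 1..elt G i}"

text \<open>
  Tuples \<open>(i\<^sub>1, \<dots>, i\<^sub>m)\<close> are indexed by the members of
  \<open>\<G>\<close> themselves rather than by an enumeration of \<open>\<G>\<close>.
\<close>

definition dual_gens :: "nat \<Rightarrow> nat set set \<Rightarrow> nat set set" where
  "dual_gens n \<G> =
     {H. H \<subseteq> {1..n} \<and>
         (\<exists>\<iota> \<in> (\<Pi>\<^sub>E G\<in>\<G>. {1..card G}). set_le H (meet ((\<lambda>G. block G (\<iota> G)) ` \<G>)))}"

end

theory Submission
  imports Defs
begin

text \<open>
  Everything is expressed through the counting functions \<open>cnt A x = |A \<inter> [x]|\<close>: \<open>A \<preceq> B\<close> means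
  \<open>cnt A \<ge> cnt B\<close> pointwise, and \<open>A\<close>, \<open>B\<close> are strongly intersecting iff they cross, i.e.
  \<open>cnt A x + cnt B x > x\<close> for some \<open>x\<close>. As the meet is the greatest lower bound for \<open>\<preceq>\<close>, the family
  \<open>\<F>(\<H>(\<G>))\<close> consists of the \<open>k\<close>-sets that contain \<open>1\<close> and cross every member of \<open>\<G>\<close>.
  Maximality then holds because the first \<open>k\<close> elements of the complement of a \<open>k\<close>-set \<open>S\<close> outside the
  family form a member disjoint from \<open>S\<close>. Conversely, an MLCIF \<open>\<A>\<close> arises from the set \<open>\<G>\<close> of all
  \<open>G \<in> \<G>\<^sub>k\<close> with \<open>1 \<notin> G\<close> and \<open>\<F>({G}) \<subseteq> \<A>\<close>.
\<close>

section \<open>Counting functions\<close>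

definition cnt :: "nat set \<Rightarrow> nat \<Rightarrow> nat" where
  "cnt A x = card (A \<inter> {..x})"

text \<open>Strong intersection as a numerical condition: a witness \<open>x\<close> means that the
  two sets together have too many elements in \<open>[x]\<close> to be disjoint there. As only
  counts occur, the condition survives moving elements down.\<close>

definition crosses :: "nat set \<Rightarrow> nat set \<Rightarrow> bool" where
  "crosses A B \<longleftrightarrow> (\<exists>x. x < cnt A x + cnt B x)"

lemma cnt_mono: "x \<le> y \<Longrightarrow> cnt A x \<le> cnt A y"
  unfolding cnt_def by (intro card_mono) auto

lemma cnt_subset_mono: "A \<subseteq> B \<Longrightarrow> cnt A x \<le> cnt B x"
  unfolding cnt_def by (intro card_mono) auto

lemma cnt_le_card: "finite A \<Longrightarrow> cnt A x \<le> card A"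
  unfolding cnt_def by (intro card_mono) auto

lemma cnt_eq_card: "A \<subseteq> {..x} \<Longrightarrow> cnt A x = card A"
  unfolding cnt_def by (simp add: Int_absorb2)

lemma cnt_le_arg: "0 \<notin> A \<Longrightarrow> cnt A x \<le> x"
proof -
  assume "0 \<notin> A"
  then have "A \<inter> {..x} \<subseteq> {1..x}" by (auto simp: Suc_le_eq intro: gr0I)
  then show ?thesis unfolding cnt_def using card_mono[of "{1..x}"] by fastforce
qed

lemma cnt_lipschitz: "x \<le> y \<Longrightarrow> cnt A y \<le> cnt A x + (y - x)"
proof -
  assume "x \<le> y"
  then have "A \<inter> {..y} \<subseteq> (A \<inter> {..x}) \<union> {x<..y}" by auto
  then have "cnt A y \<le> card ((A \<inter> {..x}) \<union> {x<..y})"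
    unfolding cnt_def by (intro card_mono) auto
  also have "\<dots> \<le> cnt A x + card {x<..y}" unfolding cnt_def by (rule card_Un_le)
  finally show ?thesis by simp
qed

lemma cnt_Int_atMost: "cnt (A \<inter> {..y}) x = min (cnt A x) (cnt A y)"
proof -
  have "A \<inter> {..y} \<inter> {..x} = A \<inter> {..min x y}" by auto
  then show ?thesis
    using cnt_mono[of x y A] cnt_mono[of y x A]
    by (auto simp: cnt_def min_def split: if_splits)
qed

section \<open>Ordered elements versus counts\<close>

lemma elt_in: "finite A \<Longrightarrow> 1 \<le> i \<Longrightarrow> i \<le> card A \<Longrightarrow> elt A i \<in> A"
  unfolding elt_def using nth_mem[of "i - 1" "sorted_list_of_set A"] by simp

lemma elt_strict_mono: "1 \<le> i \<Longrightarrow> i < j \<Longrightarrow> j \<le> card A \<Longrightarrow> elt A i < elt A j"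
  unfolding elt_def
  using sorted_wrt_nth_less[OF strict_sorted_list_of_set, of "i - 1" "j - 1" A]
  by simp

lemma inj_on_elt: "inj_on (elt A) {1..card A}"
proof (rule linorder_inj_onI')
  fix i j assume "i \<in> {1..card A}" "j \<in> {1..card A}" "i < j"
  then have "elt A i < elt A j" by (intro elt_strict_mono) auto
  then show "elt A i \<noteq> elt A j" by simp
qed

lemma elt_image: "finite A \<Longrightarrow> elt A ` {1..card A} = A"
proof -
  assume A: "finite A"
  have "inj_on (elt A) {1..card A}" by (rule inj_on_elt)
  moreover have "elt A ` {1..card A} \<subseteq> A" using elt_in[OF A] by auto
  ultimately show ?thesis using A by (simp add: card_image card_subset_eq)
qed

text \<open>The indices of the elements up to \<open>x\<close> form an initial segment of
  \<open>{1..card A}\<close>, because \<open>elt A\<close> is increasing, and its length is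
  \<open>cnt A x\<close>. This turns bounds on elements into bounds on counts and back.\<close>

lemma elt_le_iff:
  assumes A: "finite A" and i: "1 \<le> i" "i \<le> card A"
  shows "elt A i \<le> x \<longleftrightarrow> i \<le> cnt A x"
proof -
  define J where "J = {j \<in> {1..card A}. elt A j \<le> x}"
  have inj: "inj_on (elt A) {1..card A}" by (rule inj_on_elt)
  have "elt A ` J = elt A ` {1..card A} \<inter> {..x}" by (auto simp: J_def)
  then have "A \<inter> {..x} = elt A ` J" by (simp only: elt_image[OF A])
  moreover have "inj_on (elt A) J" using inj by (rule inj_on_subset) (auto simp: J_def)
  ultimately have c: "cnt A x = card J" unfolding cnt_def by (simp add: card_image)
  have finJ: "finite J" unfolding J_def by simp
  show ?thesis
  proof
    assume le: "elt A i \<le> x"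
    have "{1..i} \<subseteq> J"
    proof
      fix j assume j: "j \<in> {1..i}"
      then have "elt A j \<le> elt A i"
        using elt_strict_mono[of j i A] i by (cases "j = i") auto
      then show "j \<in> J" using j i le by (auto simp: J_def)
    qed
    then have "card {1..i} \<le> card J" by (rule card_mono[OF finJ])
    then show "i \<le> cnt A x" using c by simp
  next
    assume le: "i \<le> cnt A x"
    show "elt A i \<le> x"
    proof (rule ccontr)
      assume gt: "\<not> elt A i \<le> x"
      have "J \<subseteq> {1..<i}"
      proof
        fix j assume j: "j \<in> J"
        then have "elt A j < elt A i" using gt by (auto simp: J_def)
        then have "\<not> i < j" and "j \<noteq> i" using elt_strict_mono[of i j A] i j by (auto simp: J_def)
        then show "j \<in> {1..<i}" using j by (auto simp: J_def)
      qed
      then have "card J \<le> card {1..<i}" by (intro card_mono) auto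
      then show False using le c i by simp
    qed
  qed
qed

lemma cnt_elt: "finite A \<Longrightarrow> 1 \<le> i \<Longrightarrow> i \<le> card A \<Longrightarrow> cnt A (elt A i) = i"
proof (rule antisym)
  assume A: "finite A" and i: "1 \<le> i" "i \<le> card A"
  show "i \<le> cnt A (elt A i)" using elt_le_iff[OF A i] by blast
  show "cnt A (elt A i) \<le> i"
  proof (rule ccontr)
    assume "\<not> cnt A (elt A i) \<le> i"
    then have *: "Suc i \<le> cnt A (elt A i)" by simp
    then have le: "Suc i \<le> card A" using cnt_le_card[OF A] le_trans by blast
    then have "elt A (Suc i) \<le> elt A i" using elt_le_iff[OF A _ le] * by simp
    then show False using elt_strict_mono[of i "Suc i" A] i le by simp
  qed
qed

text \<open>Forwards, the element of \<open>B\<close> with index \<open>cnt B x\<close> is at most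
  \<open>x\<close>, hence so is the one of \<open>A\<close> with that index. Backwards, the counts
  are compared at \<open>elt B i\<close>, and at a common bound of both sets to compare
  cardinalities.\<close>

lemma set_preceq_iff_cnt:
  assumes A: "finite A" and B: "finite B"
  shows "set_preceq A B \<longleftrightarrow> (\<forall>x. cnt B x \<le> cnt A x)"
proof
  assume p: "set_preceq A B"
  show "\<forall>x. cnt B x \<le> cnt A x"
  proof
    fix x
    show "cnt B x \<le> cnt A x"
    proof (cases "cnt B x = 0")
      case False
      then have j: "1 \<le> cnt B x" by simp
      have jB: "cnt B x \<le> card B" by (rule cnt_le_card[OF B])
      with p have jA: "cnt B x \<le> card A" by (simp add: set_preceq_def)
      have "elt B (cnt B x) \<le> x" using elt_le_iff[OF B j jB] by simp
      moreover have "elt A (cnt B x) \<le> elt B (cnt B x)" using p j jB by (simp add: set_preceq_def)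
      ultimately show ?thesis using elt_le_iff[OF A j jA] by fastforce
    qed simp
  qed
next
  assume *: "\<forall>x. cnt B x \<le> cnt A x"
  obtain m where m: "A \<union> B \<subseteq> {..m}"
    using A B finite_nat_iff_bounded_le by (metis finite_Un)
  then have card: "card B \<le> card A" using * cnt_eq_card[of A m] cnt_eq_card[of B m] by (metis Un_subset_iff)
  have "elt A i \<le> elt B i" if i: "1 \<le> i" "i \<le> card B" for i
    using elt_le_iff[OF A i(1)] cnt_elt[OF B i] * i card by (metis le_trans)
  with card show "set_preceq A B" by (simp add: set_preceq_def)
qed

lemma set_le_iff: "set_le A B \<longleftrightarrow> card A = card B \<and> set_preceq A B"
  by (auto simp: set_le_def set_preceq_def)

text \<open>\<open>S\<close> is cut off at its \<open>d\<close>-th element; \<open>d = 0\<close> is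
  separate because elements are numbered from 1.\<close>

lemma initial_segment_exists:
  assumes S: "finite S" and d: "d \<le> card S"
  obtains H where "H \<subseteq> S" "card H = d" "\<And>x. cnt H x = min (cnt S x) d"
proof (cases "d = 0")
  case True
  then show ?thesis using that[of "{}"] by (simp add: cnt_def)
next
  case False
  then have c: "cnt S (elt S d) = d" using cnt_elt[OF S _ d] by simp
  show ?thesis
  proof (rule that[of "S \<inter> {..elt S d}"])
    show "card (S \<inter> {..elt S d}) = d" using c by (simp add: cnt_def)
  qed (simp_all add: cnt_Int_atMost c)
qed

lemma cnt_complement:
  assumes "S \<subseteq> {1..n}" "x \<le> n"
  shows "cnt ({1..n} - S) x + cnt S x = x"
proof -
  have "card (({1..n} - S) \<inter> {..x} \<union> S \<inter> {..x}) = cnt ({1..n} - S) x + cnt S x"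
    unfolding cnt_def by (rule card_Un_disjoint) auto
  moreover have "({1..n} - S) \<inter> {..x} \<union> S \<inter> {..x} = {1..x}" using assms by auto
  ultimately show ?thesis by simp
qed

section \<open>Crossing and strong intersection\<close>

lemma crosses_commute: "crosses A B \<longleftrightarrow> crosses B A"
  by (auto simp: crosses_def add.commute)

lemma crosses_mono:
  assumes "crosses A B" "\<And>x. cnt A x \<le> cnt A' x" "\<And>x. cnt B x \<le> cnt B' x"
  shows "crosses A' B'"
  using assms by (meson add_mono crosses_def order_less_le_trans)

text \<open>Pigeonhole: disjoint sets of positive integers have at most \<open>x\<close> elements in
  \<open>[x]\<close> altogether.\<close>

lemma crosses_imp_Int_nonempty:
  assumes "crosses A B" "0 \<notin> A" "0 \<notin> B"
  shows "A \<inter> B \<noteq> {}"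
proof
  assume dis: "A \<inter> B = {}"
  from assms obtain x where x: "x < cnt A x + cnt B x" by (auto simp: crosses_def)
  have "cnt A x + cnt B x = cnt (A \<union> B) x"
    unfolding cnt_def Int_Un_distrib2 using dis by (subst card_Un_disjoint) auto
  also have "\<dots> \<le> x" using assms by (intro cnt_le_arg) auto
  finally show False using x by simp
qed

text \<open>Processing the elements of both sets in increasing order, the \<open>t\<close>-th one is moved down to \<open>t\<close>.\<close>

lemma not_crosses_imp_disjoint_shifts:
  assumes "finite A" "finite B" "\<not> crosses A B"
  shows "\<exists>A' B'. A' \<inter> B' = {} \<and> A' \<union> B' = {1..card A + card B} \<and> card A' = card A \<and> card B' = card B \<and>
           (\<forall>x. cnt A x \<le> cnt A' x) \<and> (\<forall>x. cnt B x \<le> cnt B' x)"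
    (is "?P A B")
  using assms
proof (induction "card A + card B" arbitrary: A B)
  case 0
  then have "A = {}" "B = {}" by auto
  then show ?case by auto
next
  case (Suc m)
  \<comment> \<open>The induction removes the largest element \<open>a\<close> of both sets. Here
    \<open>a\<close> lies in the first set; \<open>A\<close> and \<open>B\<close> are generalized so
    that the other case follows by exchanging them.\<close>
  have step: "?P A B"
    if A: "finite A" and B: "finite B" and nc: "\<not> crosses A B" and m: "Suc m = card A + card B"
      and a: "a \<in> A" and max: "A \<union> B \<subseteq> {..a}" for A B a
  proof -
    have cA: "card A = Suc (card (A - {a}))" using card_Suc_Diff1[OF A a] by simp
    have le: "cnt (A - {a}) x \<le> cnt A x" for x by (rule cnt_subset_mono) auto
    have nc': "\<not> crosses (A - {a}) B" using nc crosses_mono[of "A - {a}" B A B] le by blast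
    obtain A' B' where IH: "A' \<inter> B' = {}" "A' \<union> B' = {1..card (A - {a}) + card B}"
      "card A' = card (A - {a})" "card B' = card B"
      "\<And>x. cnt (A - {a}) x \<le> cnt A' x" "\<And>x. cnt B x \<le> cnt B' x"
      using Suc.hyps(1)[of "A - {a}" B] A B nc' cA m by auto
    have m': "card (A - {a}) + card B = m" using cA m by simp
    have fin: "finite A'" using IH(2) by (metis finite_Un finite_atLeastAtMost)
    have notin: "Suc m \<notin> A'" "Suc m \<notin> B'"
    proof -
      have "Suc m \<notin> A' \<union> B'" using IH(2) m' by simp
      then show "Suc m \<notin> A'" "Suc m \<notin> B'" by auto
    qed
    \<comment> \<open>At \<open>a\<close> both counts are complete, so not crossing there gives
      \<open>Suc m \<le> a\<close>: replacing \<open>a\<close> by \<open>Suc m\<close> moves it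
      down.\<close>
    have "cnt A a + cnt B a \<le> a" using nc by (auto simp: crosses_def not_less)
    then have pa: "Suc m \<le> a" using m max cnt_eq_card[of A a] cnt_eq_card[of B a] by simp
    have dom: "cnt A x \<le> cnt (insert (Suc m) A') x" for x
    proof (cases "x < a")
      case True
      then have "A \<inter> {..x} = (A - {a}) \<inter> {..x}" by auto
      then have "cnt A x = cnt (A - {a}) x" by (simp add: cnt_def)
      also have "\<dots> \<le> cnt A' x" by (rule IH)
      also have "\<dots> \<le> cnt (insert (Suc m) A') x" by (rule cnt_subset_mono) auto
      finally show ?thesis .
    next
      case False
      have "A' \<subseteq> {1..m}" using IH(2) m' by blast
      then have "insert (Suc m) A' \<subseteq> {..x}" using pa False by force
      then have "cnt (insert (Suc m) A') x = card (insert (Suc m) A')" by (rule cnt_eq_card)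
      also have "\<dots> = card A" using fin notin IH(3) cA by simp
      finally show ?thesis using cnt_le_card[OF A] by simp
    qed
    have "insert (Suc m) A' \<union> B' = {1..card A + card B}"
      unfolding m[symmetric] using IH(2) unfolding m' by auto
    moreover have "insert (Suc m) A' \<inter> B' = {}" using IH(1) notin by auto
    moreover have "card (insert (Suc m) A') = card A" using fin notin IH(3) cA by simp
    ultimately show ?thesis using dom IH(4,6) by blast
  qed
  have fin: "finite (A \<union> B)" and ne: "A \<union> B \<noteq> {}" using Suc by auto
  define a where "a = Max (A \<union> B)"
  have sub: "A \<union> B \<subseteq> {..a}" and mem: "a \<in> A \<union> B"
    using Max_ge[OF fin] Max_in[OF fin ne] by (auto simp: a_def)
  show ?case
  proof (cases "a \<in> A")
    case True
    then show ?thesis using step[of A B a] Suc sub by blast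
  next
    case False
    then have "?P B A"
      using step[of B A a] Suc.prems Suc.hyps(2) sub mem
      by (metis Un_commute Un_iff add.commute crosses_commute)
    then show ?thesis by (metis Int_commute Un_commute add.commute)
  qed
qed

lemma strongly_intersecting_sets_iff_crosses:
  assumes A: "A \<subseteq> {1..n}" and B: "B \<subseteq> {1..n}"
  shows "strongly_intersecting_sets n A B \<longleftrightarrow> crosses A B"
proof
  have fin: "finite A" "finite B" using A B finite_subset by blast+
  show "crosses A B" if si: "strongly_intersecting_sets n A B"
  proof (rule ccontr)
    assume nc: "\<not> crosses A B"
    from not_crosses_imp_disjoint_shifts[OF fin nc] obtain A' B' where
      *: "A' \<inter> B' = {}" "A' \<union> B' = {1..card A + card B}" "card A' = card A" "card B' = card B"
        "\<forall>x. cnt A x \<le> cnt A' x" "\<forall>x. cnt B x \<le> cnt B' x" by blast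
    \<comment> \<open>Not crossing at \<open>n\<close> bounds the total size by \<open>n\<close>, so
      the disjoint shifts stay inside the ground set.\<close>
    have "cnt A n + cnt B n \<le> n" using nc by (auto simp: crosses_def not_less)
    moreover have "cnt A n = card A" "cnt B n = card B" using A B by (auto intro!: cnt_eq_card)
    ultimately have sub: "A' \<union> B' \<subseteq> {1..n}" unfolding *(2) by simp
    have fin': "finite A'" "finite B'" using *(2) by (metis finite_Un finite_atLeastAtMost)+
    have "set_le A' A" "set_le B' B"
      using * fin fin' by (simp_all add: set_le_iff set_preceq_iff_cnt)
    with si sub *(1) show False unfolding strongly_intersecting_sets_def by blast
  qed
  show "strongly_intersecting_sets n A B" if c: "crosses A B"
    unfolding strongly_intersecting_sets_def
  proof (intro allI impI)
    fix A' B' assume *: "A' \<subseteq> {1..n}" "B' \<subseteq> {1..n}" "set_le A' A" "set_le B' B"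
    have "finite A'" "finite B'" using * finite_subset by blast+
    then have "crosses A' B'"
      using * fin by (intro crosses_mono[OF c]) (simp_all add: set_le_iff set_preceq_iff_cnt)
    then show "A' \<inter> B' \<noteq> {}" by (rule crosses_imp_Int_nonempty) (use * in auto)
  qed
qed

section \<open>Meets and blocks\<close>

text \<open>The \<open>i\<close>-th minimum is at most \<open>x\<close> iff some member has at least
  \<open>i\<close> elements up to \<open>x\<close>. With counts as maxima, the meet is the greatest
  lower bound for \<open>set_preceq\<close>.\<close>

lemma cnt_meet:
  assumes fin: "finite \<S>" and ne: "\<S> \<noteq> {}" and finm: "\<And>A. A \<in> \<S> \<Longrightarrow> finite A"
  shows "cnt (meet \<S>) x = Max ((\<lambda>A. cnt A x) ` \<S>)"
proof -
  define d where "d = Max (card ` \<S>)"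
  define E where "E i = {elt A i | A. A \<in> \<S> \<and> i \<le> card A}" for i
  define J where "J = {i \<in> {1..d}. Min (E i) \<le> x}"
  have meet: "meet \<S> = (\<lambda>i. Min (E i)) ` {1..d}" using ne by (simp add: meet_def E_def d_def)
  have finE: "finite (E i)" for i unfolding E_def using fin by simp
  obtain D where D: "D \<in> \<S>" "card D = d"
  proof -
    have "d \<in> card ` \<S>" unfolding d_def using fin ne by (intro Max_in) auto
    then show ?thesis using that by blast
  qed
  have neE: "E i \<noteq> {}" if "i \<le> d" for i using D that by (auto simp: E_def)
  have card_le: "card A \<le> d" if "A \<in> \<S>" for A using that fin by (simp add: d_def)
  \<comment> \<open>The member attaining the \<open>j\<close>-th minimum has a smaller
    \<open>i\<close>-th element. Hence the minima are distinct and counting elements of the meet is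
    counting indices.\<close>
  have strict: "Min (E i) < Min (E j)" if ij: "1 \<le> i" "i < j" "j \<le> d" for i j
  proof -
    obtain A where A: "A \<in> \<S>" "j \<le> card A" "Min (E j) = elt A j"
      using Min_in[OF finE neE[OF ij(3)]] by (auto simp: E_def)
    have "Min (E i) \<le> elt A i" using A ij by (intro Min_le finE) (auto simp: E_def)
    also have "\<dots> < elt A j" using A ij by (intro elt_strict_mono) auto
    finally show ?thesis using A by simp
  qed
  have inj: "inj_on (\<lambda>i. Min (E i)) J"
    by (rule linorder_inj_onI') (use strict in \<open>fastforce simp: J_def\<close>)
  have J: "J = {1..Max ((\<lambda>A. cnt A x) ` \<S>)}"
  proof (rule set_eqI)
    fix i
    have "i \<in> J \<longleftrightarrow> 1 \<le> i \<and> (\<exists>A\<in>\<S>. i \<le> card A \<and> elt A i \<le> x)"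
    proof (cases "1 \<le> i \<and> i \<le> d")
      case True
      then have "Min (E i) \<le> x \<longleftrightarrow> (\<exists>e\<in>E i. e \<le> x)" by (simp add: Min_le_iff finE neE)
      then show ?thesis using True by (auto simp: J_def E_def)
    next
      case False
      then show ?thesis using card_le by (fastforce simp: J_def)
    qed
    also have "\<dots> \<longleftrightarrow> 1 \<le> i \<and> (\<exists>A\<in>\<S>. i \<le> cnt A x)"
      using elt_le_iff finm cnt_le_card by (meson le_trans)
    also have "\<dots> \<longleftrightarrow> i \<in> {1..Max ((\<lambda>A. cnt A x) ` \<S>)}"
      using fin ne by (simp add: Max_ge_iff)
    finally show "i \<in> J \<longleftrightarrow> i \<in> {1..Max ((\<lambda>A. cnt A x) ` \<S>)}" .
  qed
  have "meet \<S> \<inter> {..x} = (\<lambda>i. Min (E i)) ` J" unfolding meet J_def by auto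
  then have "cnt (meet \<S>) x = card J" unfolding cnt_def using inj by (simp add: card_image)
  then show ?thesis using J by simp
qed

lemma finite_meet: "finite (meet \<S>)"
  by (simp add: meet_def)

text \<open>Handles the empty meet, and the element 1 present in every block.\<close>

lemma set_preceq_singleton_1:
  assumes "finite S" "0 \<notin> S"
  shows "set_preceq S {1} \<longleftrightarrow> 1 \<in> S"
proof -
  have *: "cnt {Suc 0} x = (if x = 0 then 0 else 1)" for x by (auto simp: cnt_def)
  have "1 \<in> S \<longleftrightarrow> 1 \<le> cnt S 1"
  proof -
    have "S \<inter> {..1} = (if 1 \<in> S then {1} else {})" using assms(2) by (auto simp: le_Suc_eq)
    then show ?thesis by (simp add: cnt_def)
  qed
  also have "\<dots> \<longleftrightarrow> (\<forall>x. cnt {1} x \<le> cnt S x)"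
  proof
    assume one: "1 \<le> cnt S 1"
    show "\<forall>x. cnt {1} x \<le> cnt S x"
    proof
      fix x
      show "cnt {1} x \<le> cnt S x"
        using one cnt_mono[of 1 x S] by (cases "x = 0") (simp_all add: *)
    qed
  next
    assume "\<forall>x. cnt {1} x \<le> cnt S x"
    then have "cnt {1} 1 \<le> cnt S 1" by (rule spec)
    then show "1 \<le> cnt S 1" by (simp add: *)
  qed
  finally show ?thesis using assms by (simp add: set_preceq_iff_cnt)
qed

lemma set_preceq_meet_iff:
  assumes "finite \<S>" "\<S> \<noteq> {}" "\<And>A. A \<in> \<S> \<Longrightarrow> finite A" "finite S"
  shows "set_preceq S (meet \<S>) \<longleftrightarrow> (\<forall>A\<in>\<S>. set_preceq S A)"
  using assms by (auto simp: set_preceq_iff_cnt finite_meet cnt_meet)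

text \<open>From \<open>i\<close> to \<open>elt G i\<close> the count of the block rises by one at
  each number, the fastest rise possible. A lower bound for \<open>cnt S\<close> at
  \<open>elt G i\<close> therefore propagates down to all smaller positions, where otherwise only
  \<open>1 \<in> S\<close> is required. The inequality says that \<open>S\<close> crosses
  \<open>G\<close> at the \<open>i\<close>-th element of \<open>G\<close>.\<close>

lemma set_preceq_block_iff:
  assumes S: "finite S" "0 \<notin> S" and g: "i < elt G i" and i: "1 \<le> i"
  shows "set_preceq S (block G i) \<longleftrightarrow> 1 \<in> S \<and> elt G i < cnt S (elt G i) + i"
proof -
  let ?g = "elt G i"
  have c: "cnt (block G i) x = (if x = 0 then 0 else if x \<le> i then 1 else min x ?g - i + 1)" for x
  proof (cases "x = 0")
    case True
    then show ?thesis by (simp add: block_def cnt_def)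
  next
    case False
    then have "block G i \<inter> {..x} = insert 1 {i + 1..min x ?g}" by (auto simp: block_def)
    moreover have "card (insert 1 {i + 1..min x ?g}) = Suc (min x ?g - i)"
      using i by (subst card_insert_disjoint) auto
    ultimately show ?thesis using False by (simp add: cnt_def)
  qed
  have fb: "finite (block G i)" by (simp add: block_def)
  have one: "1 \<in> S \<longleftrightarrow> (\<forall>x. cnt {1} x \<le> cnt S x)"
    using set_preceq_singleton_1[OF S] S by (simp add: set_preceq_iff_cnt)
  have *: "cnt {Suc 0} x = (if x = 0 then 0 else 1)" for x by (auto simp: cnt_def)
  show ?thesis
    unfolding set_preceq_iff_cnt[OF S(1) fb]
  proof
    assume H: "\<forall>x. cnt (block G i) x \<le> cnt S x"
    have "cnt {1} x \<le> cnt S x" for x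
      using H[THEN spec, of x] by (auto simp: c * split: if_splits)
    moreover have "?g - i + 1 \<le> cnt S ?g" using H[THEN spec, of ?g] g by (simp add: c)
    ultimately show "1 \<in> S \<and> ?g < cnt S ?g + i" using one by auto
  next
    assume H: "1 \<in> S \<and> ?g < cnt S ?g + i"
    show "\<forall>x. cnt (block G i) x \<le> cnt S x"
    proof
      fix x
      have "cnt {1} x \<le> cnt S x" using H one by blast
      then show "cnt (block G i) x \<le> cnt S x"
        using H g cnt_lipschitz[of x ?g S] cnt_mono[of ?g x S]
        by (cases "x \<le> ?g") (auto simp: c * split: if_splits)
    qed
  qed
qed

text \<open>A witness \<open>x\<close> can be lowered to the last element of \<open>G\<close> up to
  \<open>x\<close>: the count of \<open>G\<close> stays the same, and that of \<open>S\<close> drops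
  by at most the distance moved.\<close>

lemma crosses_iff_elt:
  assumes S: "0 \<notin> S" and G: "finite G"
  shows "crosses S G \<longleftrightarrow> (\<exists>i\<in>{1..card G}. elt G i < cnt S (elt G i) + i)"
proof
  assume "crosses S G"
  then obtain x where x: "x < cnt S x + cnt G x" by (auto simp: crosses_def)
  \<comment> \<open>\<open>cnt S x \<le> x\<close> forces \<open>G\<close> to have an element up to
    \<open>x\<close>.\<close>
  have i: "1 \<le> cnt G x" using x cnt_le_arg[OF S, of x] by simp
  have i': "cnt G x \<le> card G" by (rule cnt_le_card[OF G])
  have "elt G (cnt G x) \<le> x" using elt_le_iff[OF G i i'] by simp
  then have "elt G (cnt G x) < cnt S (elt G (cnt G x)) + cnt G x"
    using cnt_lipschitz[of "elt G (cnt G x)" x S] x by linarith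
  then show "\<exists>i\<in>{1..card G}. elt G i < cnt S (elt G i) + i" using i i' by auto
next
  assume "\<exists>i\<in>{1..card G}. elt G i < cnt S (elt G i) + i"
  then obtain i where "1 \<le> i" "i \<le> card G" "elt G i < cnt S (elt G i) + i" by auto
  then have "elt G i < cnt S (elt G i) + cnt G (elt G i)" using cnt_elt[OF G] by simp
  then show "crosses S G" unfolding crosses_def by blast
qed

text \<open>The first \<open>i\<close> elements of \<open>G\<close> lie in
  \<open>{2..elt G i}\<close>. This is where \<open>1 \<notin> G\<close> makes the interval in
  \<open>block G i\<close> nonempty.\<close>

lemma lt_elt:
  assumes G: "finite G" "0 \<notin> G" "1 \<notin> G" and i: "1 \<le> i" "i \<le> card G"
  shows "i < elt G i"
proof -
  let ?g = "elt G i"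
  have "?g \<in> G" using elt_in G i by simp
  then have g: "1 \<le> ?g" using G by (metis One_nat_def Suc_leI gr0I)
  have "G \<inter> {..?g} \<subseteq> {2..?g}"
  proof
    fix y assume y: "y \<in> G \<inter> {..?g}"
    then have "y \<noteq> 0" "y \<noteq> 1" using G by (auto intro: ccontr)
    with y show "y \<in> {2..?g}" by simp
  qed
  then have "cnt G ?g \<le> card {2..?g}" unfolding cnt_def by (intro card_mono) auto
  then show ?thesis using cnt_elt[OF G(1) i] g by simp
qed

section \<open>Description of the dual family\<close>

lemma set_preceq_trans: "set_preceq A B \<Longrightarrow> set_preceq B C \<Longrightarrow> set_preceq A C"
  unfolding set_preceq_def by (meson atLeastAtMost_iff le_trans)

text \<open>The first \<open>card M\<close> elements of \<open>S\<close> serve as \<open>H\<close>.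
  So the shifts of the meet allowed in \<open>dual_gens\<close> generate the same sets as the meet
  itself.\<close>

lemma preceq_shift_iff:
  assumes S: "S \<subseteq> {1..n}" and M: "finite M"
  shows "(\<exists>H\<subseteq>{1..n}. set_le H M \<and> set_preceq S H) \<longleftrightarrow> set_preceq S M"
proof
  assume "set_preceq S M"
  have fS: "finite S" using S finite_subset by blast
  have "card M \<le> card S" using \<open>set_preceq S M\<close> by (simp add: set_preceq_def)
  from initial_segment_exists[OF fS this] obtain H where
    H: "H \<subseteq> S" "card H = card M" "\<And>x. cnt H x = min (cnt S x) (card M)" by blast
  have fH: "finite H" using H fS finite_subset by blast
  have "set_preceq H M" "set_preceq S H"
    using \<open>set_preceq S M\<close> H(3) cnt_le_card[OF M] by (simp_all add: set_preceq_iff_cnt fS fH M)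
  then show "\<exists>H\<subseteq>{1..n}. set_le H M \<and> set_preceq S H" using H S by (auto simp: set_le_iff)
qed (auto simp: set_le_iff intro: set_preceq_trans)

text \<open>Lying below a meet splits into lying below each block, and the block of \<open>G\<close>
  at index \<open>\<iota> G\<close> says that \<open>1 \<in> S\<close> and that \<open>S\<close>
  crosses \<open>G\<close> at that element. A tuple is thus a choice of one crossing position per
  generator.\<close>

lemma gen_family_dual_gens_iff:
  assumes fin: "finite \<G>" and G: "\<And>G. G \<in> \<G> \<Longrightarrow> finite G \<and> 0 \<notin> G \<and> 1 \<notin> G"
  shows "S \<in> gen_family n k (dual_gens n \<G>) \<longleftrightarrow>
    S \<in> nsets {1..n} k \<and> 1 \<in> S \<and> (\<forall>G\<in>\<G>. crosses S G)"
proof (cases "S \<in> nsets {1..n} k")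
  case True
  then have S: "S \<subseteq> {1..n}" "finite S" "0 \<notin> S" by (auto simp: nsets_def)
  let ?M = "\<lambda>\<iota>. meet ((\<lambda>G. block G (\<iota> G)) ` \<G>)"
  have "S \<in> gen_family n k (dual_gens n \<G>) \<longleftrightarrow>
      (\<exists>\<iota>\<in>(\<Pi>\<^sub>E G\<in>\<G>. {1..card G}). \<exists>H\<subseteq>{1..n}. set_le H (?M \<iota>) \<and> set_preceq S H)"
    using True unfolding gen_family_def dual_gens_def by blast
  also have "\<dots> \<longleftrightarrow> (\<exists>\<iota>\<in>(\<Pi>\<^sub>E G\<in>\<G>. {1..card G}). set_preceq S (?M \<iota>))"
    using preceq_shift_iff[OF S(1) finite_meet] by simp
  also have "\<dots> \<longleftrightarrow> 1 \<in> S \<and> (\<forall>G\<in>\<G>. crosses S G)"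
  \<comment> \<open>Without generators no block yields \<open>1 \<in> S\<close>; the convention for
    the empty meet supplies it.\<close>
  proof (cases "\<G> = {}")
    case True
    then show ?thesis using set_preceq_singleton_1[OF S(2,3)] by (simp add: meet_def)
  next
    case False
    have pm: "set_preceq S (?M \<iota>) \<longleftrightarrow> (\<forall>G\<in>\<G>. 1 \<in> S \<and> elt G (\<iota> G) < cnt S (elt G (\<iota> G)) + \<iota> G)"
      if \<iota>: "\<iota> \<in> (\<Pi>\<^sub>E G\<in>\<G>. {1..card G})" for \<iota>
    proof -
      have "set_preceq S (?M \<iota>) \<longleftrightarrow> (\<forall>G\<in>\<G>. set_preceq S (block G (\<iota> G)))"
        using fin False S by (subst set_preceq_meet_iff) (auto simp: block_def)
      also have "\<dots> \<longleftrightarrow> (\<forall>G\<in>\<G>. 1 \<in> S \<and> elt G (\<iota> G) < cnt S (elt G (\<iota> G)) + \<iota> G)"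
      proof (intro ball_cong refl)
        fix A assume A: "A \<in> \<G>"
        then have "\<iota> A \<in> {1..card A}" using \<iota> by blast
        then show "set_preceq S (block A (\<iota> A)) \<longleftrightarrow>
            1 \<in> S \<and> elt A (\<iota> A) < cnt S (elt A (\<iota> A)) + \<iota> A"
          using lt_elt[of A "\<iota> A"] G[OF A] S by (intro set_preceq_block_iff) auto
      qed
      finally show ?thesis .
    qed
    show ?thesis
    proof
      assume "\<exists>\<iota>\<in>(\<Pi>\<^sub>E G\<in>\<G>. {1..card G}). set_preceq S (?M \<iota>)"
      then obtain \<iota> where \<iota>: "\<iota> \<in> (\<Pi>\<^sub>E G\<in>\<G>. {1..card G})" "set_preceq S (?M \<iota>)" by blast
      with pm have *: "\<forall>G\<in>\<G>. 1 \<in> S \<and> elt G (\<iota> G) < cnt S (elt G (\<iota> G)) + \<iota> G" by blast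
      have "crosses S A" if A: "A \<in> \<G>" for A
        using crosses_iff_elt[of S A] G[OF A] S(3) * A \<iota>(1) by blast
      then show "1 \<in> S \<and> (\<forall>G\<in>\<G>. crosses S G)" using * False by blast
    next
      assume H: "1 \<in> S \<and> (\<forall>G\<in>\<G>. crosses S G)"
      then have "\<forall>G\<in>\<G>. \<exists>i\<in>{1..card G}. elt G i < cnt S (elt G i) + i"
        using crosses_iff_elt[OF S(3)] G by blast
      then obtain f where f: "\<forall>G\<in>\<G>. f G \<in> {1..card G} \<and> elt G (f G) < cnt S (elt G (f G)) + f G"
        by metis
      have "restrict f \<G> \<in> (\<Pi>\<^sub>E G\<in>\<G>. {1..card G})" using f by auto
      moreover have "set_preceq S (?M (restrict f \<G>))" using f H by (subst pm[OF calculation]) simp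
      ultimately show "\<exists>\<iota>\<in>(\<Pi>\<^sub>E G\<in>\<G>. {1..card G}). set_preceq S (?M \<iota>)" by blast
    qed
  qed
  finally show ?thesis using True by simp
qed (simp add: gen_family_def)

section \<open>Generators and generated families\<close>

lemma generatorsD:
  assumes "G \<in> generators k"
  shows "G \<subseteq> {1..2 * k - 1}" "card G \<le> k" "G \<subseteq> {1..k + card G - 1}" "finite G" "0 \<notin> G"
proof -
  show sub: "G \<subseteq> {1..2 * k - 1}" and "card G \<le> k" using assms by (auto simp: generators_def)
  show fin: "finite G" using sub finite_subset by blast
  show "0 \<notin> G" using sub by auto
  have "card (G \<inter> {1..k + card G - 1}) = card G" using assms by (simp add: generators_def)
  then have "G \<inter> {1..k + card G - 1} = G" using fin by (intro card_subset_eq) auto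
  then show "G \<subseteq> {1..k + card G - 1}" by blast
qed

lemma finite_generators: "finite (generators k)"
  by (rule finite_subset[of _ "Pow {1..2 * k - 1}"]) (auto simp: generators_def)

lemma PGS_D:
  assumes "PGS n k \<G>" and "2 * k \<le> n"
  shows "finite \<G>" "\<And>G. G \<in> \<G> \<Longrightarrow> G \<in> generators k" "\<And>G. G \<in> \<G> \<Longrightarrow> 1 \<notin> G"
    "\<And>A B. A \<in> \<G> \<Longrightarrow> B \<in> \<G> \<Longrightarrow> crosses A B"
proof -
  show gen: "\<And>G. G \<in> \<G> \<Longrightarrow> G \<in> generators k" and "\<And>G. G \<in> \<G> \<Longrightarrow> 1 \<notin> G"
    using assms by (auto simp: PGS_def generators_avoiding_1_def)
  show "finite \<G>" using gen finite_generators finite_subset by (metis subsetI)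
  fix A B assume AB: "A \<in> \<G>" "B \<in> \<G>"
  have "G \<subseteq> {1..n}" if "G \<in> \<G>" for G using generatorsD(1)[OF gen[OF that]] assms(2) by fastforce
  then show "crosses A B"
    using AB assms(1) strongly_intersecting_sets_iff_crosses[of A n B]
    by (auto simp: PGS_def strongly_intersecting_def)
qed

lemma nsetsD:
  fixes n k :: nat
  assumes "S \<in> nsets {1..n} k"
  shows "S \<subseteq> {1..n}" "finite S" "card S = k" "0 \<notin> S"
proof -
  show S: "S \<subseteq> {1..n}" and "finite S" "card S = k" using assms by (auto simp: nsets_def)
  show "0 \<notin> S" using S by auto
qed

lemma gen_family_iff:
  assumes "\<And>G. G \<in> \<G> \<Longrightarrow> finite G"
  shows "S \<in> gen_family n k \<G> \<longleftrightarrow> S \<in> nsets {1..n} k \<and> (\<exists>G\<in>\<G>. \<forall>x. cnt G x \<le> cnt S x)"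
proof (cases "S \<in> nsets {1..n} k")
  case True
  then have "set_preceq S G \<longleftrightarrow> (\<forall>x. cnt G x \<le> cnt S x)" if "G \<in> \<G>" for G
    using that assms by (simp add: set_preceq_iff_cnt nsetsD(2))
  with True show ?thesis unfolding gen_family_def by blast
qed (simp add: gen_family_def)

section \<open>Disjoint sets inside the complement\<close>

text \<open>\<open>T\<close> consists of the first \<open>k\<close> elements of the complement,
  which has \<open>n - k \<ge> k\<close> elements. It has the largest counts possible for a
  \<open>k\<close>-set disjoint from \<open>S\<close>.\<close>

lemma disjoint_initial_segment:
  assumes S: "S \<in> nsets {1..n} k" and kn: "2 * k \<le> n"
  obtains T where "T \<in> nsets {1..n} k" "S \<inter> T = {}"
    "\<And>x. x \<le> n \<Longrightarrow> cnt T x = min (x - cnt S x) k" "\<And>x. n \<le> x \<Longrightarrow> cnt T x = k"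
proof -
  note S' = nsetsD[OF S]
  have card: "card ({1..n} - S) = n - k" using S' by (simp add: card_Diff_subset)
  obtain T where T: "T \<subseteq> {1..n} - S" "card T = k" "\<And>x. cnt T x = min (cnt ({1..n} - S) x) k"
    by (rule initial_segment_exists[of "{1..n} - S" k]) (use kn card in auto)
  show ?thesis
  proof
    have "finite T" using T(1) finite_subset by blast
    then show "T \<in> nsets {1..n} k" "S \<inter> T = {}" using T by (auto simp: nsets_def)
    show "cnt T x = min (x - cnt S x) k" if "x \<le> n" for x
      using T(3) cnt_complement[OF S'(1) that] by (metis add_diff_cancel_right')
    show "cnt T x = k" if "n \<le> x" for x
      using T(1) that cnt_eq_card[of T x] T(2) by fastforce
  qed
qed

text \<open>Not crossing means \<open>cnt G x \<le> x - cnt S x\<close>, and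
  \<open>card G \<le> k\<close>; the leftmost disjoint \<open>k\<close>-set attains the minimum of
  these two bounds on \<open>[n]\<close>.\<close>

lemma not_crosses_generator_imp_disjoint:
  assumes S: "S \<in> nsets {1..n} k" and kn: "2 * k \<le> n"
    and G: "finite G" "card G \<le> k" and nc: "\<not> crosses S G"
  obtains T where "T \<in> nsets {1..n} k" "S \<inter> T = {}" "\<And>x. cnt G x \<le> cnt T x"
proof -
  obtain T where T: "T \<in> nsets {1..n} k" "S \<inter> T = {}"
    "\<And>x. x \<le> n \<Longrightarrow> cnt T x = min (x - cnt S x) k" "\<And>x. n \<le> x \<Longrightarrow> cnt T x = k"
    using disjoint_initial_segment[OF S kn] by blast
  have "cnt G x \<le> cnt T x" for x
  proof (cases "x \<le> n")
    case True
    have "cnt S x + cnt G x \<le> x" using nc by (auto simp: crosses_def not_less)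
    then show ?thesis using T(3)[OF True] cnt_le_card[OF G(1), of x] G(2) by simp
  next
    case False
    then show ?thesis using T(4)[of x] cnt_le_card[OF G(1), of x] G(2) by simp
  qed
  then show ?thesis using that T by blast
qed

text \<open>The leftmost \<open>k\<close>-set disjoint from \<open>S\<close> starts with 1. Where
  \<open>G\<close> has more elements than \<open>S\<close>, it crosses \<open>G\<close> as long as
  its count is still that of the whole complement; once its count is \<open>k\<close>, the bound on
  the largest element of \<open>G\<close> takes over.\<close>

lemma disjoint_crossing_all_generators:
  assumes S: "S \<in> nsets {1..n} k" and k: "1 \<le> k" "2 * k \<le> n" and "1 \<notin> S"
    and gen: "\<And>G. G \<in> \<G> \<Longrightarrow> G \<in> generators k"
    and notle: "\<And>G. G \<in> \<G> \<Longrightarrow> \<exists>x. cnt S x < cnt G x"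
  obtains T where "T \<in> nsets {1..n} k" "S \<inter> T = {}" "1 \<in> T" "\<And>G. G \<in> \<G> \<Longrightarrow> crosses T G"
proof -
  obtain T where T: "T \<in> nsets {1..n} k" "S \<inter> T = {}"
    "\<And>x. x \<le> n \<Longrightarrow> cnt T x = min (x - cnt S x) k"
    using disjoint_initial_segment[OF S k(2)] by blast
  have "S \<inter> {..1} = {}" using \<open>1 \<notin> S\<close> nsetsD(4)[OF S] by (auto simp: le_Suc_eq)
  then have "cnt S 1 = 0" by (simp add: cnt_def)
  then have "cnt T 1 = 1" using T(3)[of 1] k by simp
  then have "T \<inter> {..1} \<noteq> {}" by (auto simp: cnt_def)
  then have "1 \<in> T" using nsetsD(4)[OF T(1)] by (auto simp: le_Suc_eq)
  moreover have "crosses T G" if G: "G \<in> \<G>" for G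
  proof -
    note G' = generatorsD[OF gen[OF G]]
    obtain x where x: "cnt S x < cnt G x" using notle[OF G] by blast
    \<comment> \<open>\<open>z\<close> bounds the largest element of \<open>G\<close>, so lowering
      \<open>x\<close> to \<open>y\<close> keeps the count of \<open>G\<close> and places
      \<open>y\<close> in the range where \<open>cnt T\<close> is known.\<close>
    define z where "z = k + card G - 1"
    define y where "y = min x z"
    have Gz: "cnt G z = card G" using G'(3) by (intro cnt_eq_card) (auto simp: z_def)
    have yn: "y \<le> n" using k G'(2) by (auto simp: y_def z_def)
    have "cnt G y = cnt G x"
      using Gz cnt_le_card[OF G'(4), of x] cnt_mono[of z x G] by (auto simp: y_def min_def)
    moreover have "cnt S y \<le> cnt S x" by (rule cnt_mono) (simp add: y_def)
    ultimately have "cnt S y < cnt G y" using x by simp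
    moreover have "y < k + cnt G y"
    proof -
      have "y \<le> z" by (simp add: y_def)
      then have "card G \<le> cnt G y + (z - y)" using cnt_lipschitz[of y z G] Gz by simp
      then show ?thesis using \<open>y \<le> z\<close> k(1) by (simp add: z_def)
    qed
    moreover have "cnt S y \<le> y" using cnt_le_arg[OF nsetsD(4)[OF S]] .
    \<comment> \<open>\<open>cnt T y\<close> is a minimum: for \<open>y - cnt S y\<close> the strict
      inequality of counts is used, for \<open>k\<close> the bound
      \<open>y < k + cnt G y\<close>.\<close>
    ultimately have "y < cnt T y + cnt G y" using T(3)[OF yn] by auto
    then show ?thesis by (auto simp: crosses_def)
  qed
  ultimately show ?thesis using that T by blast
qed

section \<open>From a PGS to an MLCIF\<close>

text \<open>A member above a generator crosses every member of either part, and two members of the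
  dual part share 1. For maximality, a \<open>k\<close>-set outside that contains 1 fails to cross
  some \<open>G\<close> and misses a set above \<open>G\<close>; one without 1 is above no generator
  and misses a set of the dual part.\<close>

lemma PGS_imp_MLCIF:
  assumes k: "1 \<le> k" "2 * k \<le> n" and P: "PGS n k \<G>"
  shows "MLCIF n k (gen_family n k \<G> \<union> gen_family n k (dual_gens n \<G>))" (is "MLCIF n k ?A")
proof -
  note D = PGS_D[OF P k(2)]
  have fin: "finite G" "0 \<notin> G" if "G \<in> \<G>" for G using generatorsD(4,5)[OF D(2)[OF that]] .
  have dual: "S \<in> gen_family n k (dual_gens n \<G>) \<longleftrightarrow>
      S \<in> nsets {1..n} k \<and> 1 \<in> S \<and> (\<forall>G\<in>\<G>. crosses S G)" for S
    using D fin by (intro gen_family_dual_gens_iff) auto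
  note primal = gen_family_iff[of \<G>, OF fin(1)]
  have sub: "?A \<subseteq> nsets {1..n} k" by (auto simp: gen_family_def)
  have "left_compressed n k ?A"
    unfolding left_compressed_def gen_family_def
    by (auto simp: set_le_iff intro: set_preceq_trans)
  moreover have cross: "S \<inter> T \<noteq> {}"
    if S: "S \<in> gen_family n k \<G>" and T: "T \<in> ?A" for S T
  proof -
    have nS: "S \<in> nsets {1..n} k" and nT: "T \<in> nsets {1..n} k" using S T sub by auto
    from S obtain G where G: "G \<in> \<G>" "\<And>x. cnt G x \<le> cnt S x" using primal by auto
    have "crosses G T"
    proof (cases "T \<in> gen_family n k \<G>")
      case True
      then obtain G' where "G' \<in> \<G>" "\<And>x. cnt G' x \<le> cnt T x" using primal by auto
      then show ?thesis using crosses_mono[OF D(4)[OF G(1)]] by blast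
    next
      case False
      then show ?thesis using T dual G(1) crosses_commute by blast
    qed
    then have "crosses S T" using G(2) crosses_mono by blast
    then show ?thesis using crosses_imp_Int_nonempty nsetsD(4)[OF nS] nsetsD(4)[OF nT] by blast
  qed
  have "S \<inter> T \<noteq> {}" if "S \<in> ?A" "T \<in> ?A" for S T
  proof (cases "S \<in> gen_family n k \<G> \<or> T \<in> gen_family n k \<G>")
    case True
    then show ?thesis using that cross by (metis Int_commute)
  next
    case False
    then show ?thesis using that dual by blast
  qed
  then have "intersecting ?A" unfolding intersecting_def by blast
  moreover have "\<not> intersecting (insert S ?A)" if S: "S \<in> nsets {1..n} k" "S \<notin> ?A" for S
  proof -
    have "\<exists>T\<in>?A. S \<inter> T = {}"
    proof (cases "1 \<in> S")
      case True
      then obtain G where G: "G \<in> \<G>" "\<not> crosses S G" using S dual by blast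
      obtain T where "T \<in> nsets {1..n} k" "S \<inter> T = {}" "\<And>x. cnt G x \<le> cnt T x"
        using not_crosses_generator_imp_disjoint[OF S(1) k(2) fin(1)[OF G(1)] _ G(2)]
          generatorsD(2)[OF D(2)[OF G(1)]] by blast
      then show ?thesis using primal G(1) by blast
    next
      case False
      have "\<exists>x. cnt S x < cnt G x" if "G \<in> \<G>" for G
        using S that primal by (meson UnI1 not_less)
      then obtain T where T: "T \<in> nsets {1..n} k" "S \<inter> T = {}" "1 \<in> T"
        "\<And>G. G \<in> \<G> \<Longrightarrow> crosses T G"
        using disjoint_crossing_all_generators[OF S(1) k False D(2)] by blast
      then have "T \<in> gen_family n k (dual_gens n \<G>)" by (simp add: dual)
      then show ?thesis using T(2) by blast
    qed
    then show ?thesis unfolding intersecting_def by blast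
  qed
  ultimately show ?thesis using sub by (auto simp: MLCIF_def maximal_intersecting_def)
qed

section \<open>From an MLCIF to a PGS\<close>

text \<open>Left-compression places all shifts of two members in the family, so intersecting
  improves to strongly intersecting, that is, to crossing.\<close>

lemma MLCIF_D:
  assumes "MLCIF n k \<A>"
  shows "\<A> \<subseteq> nsets {1..n} k" "\<And>S T. S \<in> \<A> \<Longrightarrow> T \<in> \<A> \<Longrightarrow> S \<inter> T \<noteq> {}"
    "\<And>S T. S \<in> \<A> \<Longrightarrow> T \<in> \<A> \<Longrightarrow> crosses S T"
proof -
  show sub: "\<A> \<subseteq> nsets {1..n} k" using assms by (simp add: MLCIF_def)
  show int: "\<And>S T. S \<in> \<A> \<Longrightarrow> T \<in> \<A> \<Longrightarrow> S \<inter> T \<noteq> {}"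
    using assms unfolding MLCIF_def maximal_intersecting_def intersecting_def by blast
  fix S T assume ST: "S \<in> \<A>" "T \<in> \<A>"
  have down: "B \<in> \<A>" if "A \<in> \<A>" "B \<subseteq> {1..n}" "set_le B A" for A B
  proof -
    have "card B = k" using that sub nsetsD(3) by (metis set_le_iff subsetD)
    moreover have "finite B" using that finite_subset by blast
    ultimately have "B \<in> nsets {1..n} k" using that by (simp add: nsets_def)
    then show ?thesis using assms that unfolding MLCIF_def left_compressed_def by blast
  qed
  have "strongly_intersecting_sets n S T"
    unfolding strongly_intersecting_sets_def
  proof (intro allI impI)
    fix S' T' assume "S' \<subseteq> {1..n}" "T' \<subseteq> {1..n}" "set_le S' S" "set_le T' T"
    then show "S' \<inter> T' \<noteq> {}" by (intro int down[OF ST(1)] down[OF ST(2)])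
  qed
  moreover have "S \<subseteq> {1..n}" "T \<subseteq> {1..n}" using ST sub nsetsD(1) by blast+
  ultimately show "crosses S T" by (simp add: strongly_intersecting_sets_iff_crosses)
qed

lemma MLCIF_I_mem:
  assumes "MLCIF n k \<A>" "1 \<le> k" "T \<in> nsets {1..n} k" "\<And>S. S \<in> \<A> \<Longrightarrow> S \<inter> T \<noteq> {}"
  shows "T \<in> \<A>"
proof (rule ccontr)
  assume "T \<notin> \<A>"
  \<comment> \<open>The pair of \<open>T\<close> with itself must intersect as well; this takes
    \<open>1 \<le> k\<close>.\<close>
  have "T \<noteq> {}" using assms(2,3) by (auto simp: nsets_def)
  then have "intersecting (insert T \<A>)"
    unfolding intersecting_def using assms(4) MLCIF_D(2)[OF assms(1)] by (auto simp: Int_commute)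
  then show False using assms(1,3) \<open>T \<notin> \<A>\<close> by (auto simp: MLCIF_def maximal_intersecting_def)
qed

text \<open>
  If \<open>y\<close> is the last number with \<open>y < k + cnt S y\<close>, no \<open>x > y\<close> can witness that a \<open>k\<close>-set crosses
  \<open>S\<close>; so \<open>S \<inter> [y]\<close> crosses the same \<open>k\<close>-sets as \<open>S\<close>.
\<close>

lemma MLCIF_member_has_generator:
  assumes k: "1 \<le> k" "2 * k \<le> n" and M: "MLCIF n k \<A>" and S: "S \<in> \<A>"
  obtains G where "G \<in> generators k" "G \<subseteq> S" "gen_family n k {G} \<subseteq> \<A>"
proof -
  have nS: "S \<in> nsets {1..n} k" using MLCIF_D(1)[OF M] S by blast
  note S' = nsetsD[OF nS]
  define Y where "Y = {x. x < k + cnt S x}"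
  define y where "y = Max Y"
  define G where "G = S \<inter> {..y}"
  have "Y \<subseteq> {..<2 * k}"
  proof
    fix x assume "x \<in> Y"
    then show "x \<in> {..<2 * k}" using cnt_le_card[OF S'(2), of x] S'(3) by (simp add: Y_def)
  qed
  then have finY: "finite Y" using finite_subset by blast
  have "0 \<in> Y" using k by (simp add: Y_def)
  then have "y \<in> Y" using Max_in[OF finY] by (auto simp: y_def)
  \<comment> \<open>\<open>cnt S y\<close> is \<open>card G\<close>, so membership of
    \<open>y\<close> in \<open>Y\<close> is the bound on the largest element demanded of
    generators.\<close>
  then have y: "y < k + card G" by (simp add: Y_def G_def cnt_def)
  have beyond: "k + cnt S x \<le> x" if "y < x" for x
    using Max_ge[OF finY, of x] that by (auto simp: y_def Y_def not_less[symmetric])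
  have finG: "finite G" unfolding G_def using S' by simp
  have cardG: "card G \<le> k" using S' by (metis G_def card_mono inf_le1)
  have subG: "G \<subseteq> {1..k + card G - 1}"
  proof
    fix x assume "x \<in> G"
    then have "x \<in> {1..n}" "x \<le> y" using S'(1) by (auto simp: G_def)
    then show "x \<in> {1..k + card G - 1}" using y by auto
  qed
  have "G \<in> generators k"
    using subG cardG by (force simp: generators_def Int_absorb2)
  moreover have "G \<subseteq> S" by (simp add: G_def)
  moreover have "gen_family n k {G} \<subseteq> \<A>"
  proof
    fix T assume "T \<in> gen_family n k {G}"
    then have T: "T \<in> nsets {1..n} k" "\<And>x. cnt G x \<le> cnt T x"
      using gen_family_iff[of "{G}" T n k] finG by auto
    show "T \<in> \<A>"
    proof (rule MLCIF_I_mem[OF M k(1) T(1)])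
      fix U assume U: "U \<in> \<A>"
      then have nU: "U \<in> nsets {1..n} k" using MLCIF_D(1)[OF M] by blast
      obtain x where x: "x < cnt U x + cnt S x"
        using MLCIF_D(3)[OF M U S] by (auto simp: crosses_def)
      have "x \<le> y"
        using beyond[of x] x cnt_le_card[OF nsetsD(2)[OF nU], of x] nsetsD(3)[OF nU]
        by (cases "x \<le> y") auto
      then have "cnt G x = cnt S x" using cnt_mono[of x y S] by (simp add: G_def cnt_Int_atMost)
      then have "crosses U T" using x T(2)[of x] unfolding crosses_def by (intro exI[of _ x]) simp
      then show "U \<inter> T \<noteq> {}"
        using crosses_imp_Int_nonempty nsetsD(4)[OF nU] nsetsD(4)[OF T(1)] by blast
    qed
  qed
  ultimately show ?thesis using that by blast
qed

text \<open>The disjoint shifts have at most \<open>k\<close> elements each, and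
  \<open>2 * k \<le> n\<close> leaves room to pad them with fresh elements to disjoint
  \<open>k\<close>-sets; padding only raises counts.\<close>

lemma not_crosses_imp_disjoint_nsets:
  assumes kn: "2 * k \<le> n" and A: "finite A" "card A \<le> k" and B: "finite B" "card B \<le> k"
    and nc: "\<not> crosses A B"
  obtains S T where "S \<in> nsets {1..n} k" "T \<in> nsets {1..n} k" "S \<inter> T = {}"
    "\<And>x. cnt A x \<le> cnt S x" "\<And>x. cnt B x \<le> cnt T x"
proof -
  from not_crosses_imp_disjoint_shifts[OF A(1) B(1) nc] obtain A' B' where
    *: "A' \<inter> B' = {}" "A' \<union> B' = {1..card A + card B}" "card A' = card A" "card B' = card B"
      "\<And>x. cnt A x \<le> cnt A' x" "\<And>x. cnt B x \<le> cnt B' x" by blast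
  have fin: "finite A'" "finite B'" using *(2) by (metis finite_Un finite_atLeastAtMost)+
  have sub: "A' \<union> B' \<subseteq> {1..n}" using *(2) A(2) B(2) kn by auto
  have "card (A' \<union> B') = card A + card B" using *(2) by simp
  then have "card ({1..n} - (A' \<union> B')) = n - (card A + card B)"
    using sub fin by (simp add: card_Diff_subset)
  then have "k - card A \<le> card ({1..n} - (A' \<union> B'))" using kn A B by simp
  then obtain C where C: "C \<subseteq> {1..n} - (A' \<union> B')" "card C = k - card A"
    by (rule obtain_subset_with_card_n) blast
  have finC: "finite C" using C finite_subset by blast
  have cS: "card (A' \<union> C) = k" using C fin finC * A by (subst card_Un_disjoint) auto
  have nS: "A' \<union> C \<in> nsets {1..n} k" using cS C sub fin finC by (auto simp: nsets_def)
  have sub': "(A' \<union> C) \<union> B' \<subseteq> {1..n}" using C sub by auto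
  have "card ((A' \<union> C) \<union> B') = k + card B"
    using cS C fin finC * by (subst card_Un_disjoint) auto
  then have "card ({1..n} - ((A' \<union> C) \<union> B')) = n - (k + card B)"
    using sub' fin finC by (subst card_Diff_subset) auto
  then have "k - card B \<le> card ({1..n} - ((A' \<union> C) \<union> B'))" using kn A B by simp
  then obtain E where E: "E \<subseteq> {1..n} - ((A' \<union> C) \<union> B')" "card E = k - card B"
    by (rule obtain_subset_with_card_n) blast
  have finE: "finite E" using E finite_subset by blast
  have cT: "card (B' \<union> E) = k" using E fin finE * B by (subst card_Un_disjoint) auto
  have nT: "B' \<union> E \<in> nsets {1..n} k" using cT E sub fin finE by (auto simp: nsets_def)
  have "(A' \<union> C) \<inter> (B' \<union> E) = {}" using *(1) C(1) E(1) by auto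
  moreover have "cnt A x \<le> cnt (A' \<union> C) x" "cnt B x \<le> cnt (B' \<union> E) x" for x
    using *(5,6)[of x] cnt_subset_mono[of A' "A' \<union> C" x] cnt_subset_mono[of B' "B' \<union> E" x]
    by (meson Un_upper1 le_trans)+
  ultimately show ?thesis using that nS nT by blast
qed

text \<open>Two generators that did not cross would have disjoint \<open>k\<close>-sets above them,
  both in \<open>\<A>\<close>. Members of \<open>\<A>\<close> without 1 lie above a generator
  contained in them; those with 1 cross every generator, since otherwise they would miss a member of
  \<open>\<A>\<close>.\<close>

lemma MLCIF_imp_PGS:
  assumes k: "1 \<le> k" "2 * k \<le> n" and M: "MLCIF n k \<A>"
  shows "\<exists>\<G>. PGS n k \<G> \<and> \<A> = gen_family n k \<G> \<union> gen_family n k (dual_gens n \<G>)"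
proof -
  define \<G> where "\<G> = {G \<in> generators_avoiding_1 k. gen_family n k {G} \<subseteq> \<A>}"
  have gen: "G \<in> generators k" "1 \<notin> G" if "G \<in> \<G>" for G
    using that by (auto simp: \<G>_def generators_avoiding_1_def)
  have fin: "finite G" "0 \<notin> G" if "G \<in> \<G>" for G using generatorsD(4,5)[OF gen(1)[OF that]] .
  have FG: "gen_family n k \<G> \<subseteq> \<A>" by (auto simp: \<G>_def gen_family_def)
  have mem: "S \<in> \<A>" if "G \<in> \<G>" "S \<in> nsets {1..n} k" "\<And>x. cnt G x \<le> cnt S x" for G S
    using FG that fin gen_family_iff[of \<G> S n k] by blast
  have "crosses A B" if A: "A \<in> \<G>" and B: "B \<in> \<G>" for A B
  proof (rule ccontr)
    assume "\<not> crosses A B"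
    then obtain S T where "S \<in> nsets {1..n} k" "T \<in> nsets {1..n} k" "S \<inter> T = {}"
      "\<And>x. cnt A x \<le> cnt S x" "\<And>x. cnt B x \<le> cnt T x"
      using not_crosses_imp_disjoint_nsets[OF k(2) fin(1)[OF A] _ fin(1)[OF B]]
        generatorsD(2)[OF gen(1)[OF A]] generatorsD(2)[OF gen(1)[OF B]] by blast
    then show False using mem[OF A] mem[OF B] MLCIF_D(2)[OF M] by blast
  qed
  moreover have "G \<subseteq> {1..n}" if "G \<in> \<G>" for G
    using generatorsD(1)[OF gen(1)[OF that]] k by fastforce
  ultimately have P: "PGS n k \<G>"
    by (auto simp: PGS_def strongly_intersecting_def strongly_intersecting_sets_iff_crosses \<G>_def)
  let ?F = "gen_family n k \<G> \<union> gen_family n k (dual_gens n \<G>)"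
  have dual: "S \<in> gen_family n k (dual_gens n \<G>) \<longleftrightarrow>
      S \<in> nsets {1..n} k \<and> 1 \<in> S \<and> (\<forall>G\<in>\<G>. crosses S G)" for S
    using PGS_D(1)[OF P k(2)] gen fin by (intro gen_family_dual_gens_iff) auto
  have sub: "\<A> \<subseteq> ?F"
  proof
    fix S assume S: "S \<in> \<A>"
    then have nS: "S \<in> nsets {1..n} k" using MLCIF_D(1)[OF M] by blast
    show "S \<in> ?F"
    proof (cases "1 \<in> S")
      case True
      have "crosses S G" if G: "G \<in> \<G>" for G
      proof (rule ccontr)
        assume "\<not> crosses S G"
        then obtain T where "T \<in> nsets {1..n} k" "S \<inter> T = {}" "\<And>x. cnt G x \<le> cnt T x"
          using not_crosses_generator_imp_disjoint[OF nS k(2) fin(1)[OF G]]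
            generatorsD(2)[OF gen(1)[OF G]] by blast
        then show False using mem[OF G] MLCIF_D(2)[OF M S] by blast
      qed
      then show ?thesis using dual nS True by blast
    next
      case False
      obtain G where G: "G \<in> generators k" "G \<subseteq> S" "gen_family n k {G} \<subseteq> \<A>"
        using MLCIF_member_has_generator[OF k M S] by blast
      then have "G \<in> \<G>" using False by (auto simp: \<G>_def generators_avoiding_1_def)
      then show ?thesis
        using nS cnt_subset_mono[OF G(2)] gen_family_iff[of \<G> S n k] fin by blast
    qed
  qed
  \<comment> \<open>By the first direction \<open>?F\<close> is intersecting. As it contains
    \<open>\<A>\<close>, each of its sets meets all of \<open>\<A>\<close> and belongs to it by
    maximality.\<close>
  moreover have "?F \<subseteq> \<A>"
  proof
    fix S assume S: "S \<in> ?F"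
    have F: "MLCIF n k ?F" by (rule PGS_imp_MLCIF[OF k P])
    show "S \<in> \<A>"
      using MLCIF_I_mem[OF M k(1)] MLCIF_D(1)[OF F] MLCIF_D(2)[OF F] S sub by blast
  qed
  ultimately show ?thesis using P by blast
qed

theorem theorem1p3:
  fixes n k :: nat
  assumes "4 \<le> 2 * k" and "2 * k \<le> n"
  shows "(\<forall>\<G>. PGS n k \<G> \<longrightarrow>
            MLCIF n k (gen_family n k \<G> \<union> gen_family n k (dual_gens n \<G>))) \<and>
         (\<forall>\<A>. MLCIF n k \<A> \<longrightarrow>
            (\<exists>\<G>. PGS n k \<G> \<and>
                  \<A> = gen_family n k \<G> \<union> gen_family n k (dual_gens n \<G>)))"
  using assms PGS_imp_MLCIF[of k n] MLCIF_imp_PGS[of k n] by auto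

end
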